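(* Let $d$ be a positive integer and let $H\subset\mathbb{N}^d\setminus\{\mathbf{0}\}$. Then $\mathbb{N}^d\setminus H$ is a monoid (i.e. a submonoid of $(\mathbb{N}^d,+)$) if and only if for every $\mathbf{h}\in H$ one has $\mathbf{h}-\mathbf{x}\in H$ for all $\mathbf{x}\in\operatorname{B}(\mathbf{h})\setminus H$.
   Context: $\mathbb{N}$ is the set of non-negative integers. For $\mathbf{x}\in\mathbb{N}^d$, $\operatorname{B}(\mathbf{x})=\{\mathbf{n}\in\mathbb{N}^d\mid\mathbf{n}\le\mathbf{x}\}$, where $\le$ denotes the usual (componentwise) partial order in $\mathbb{N}^d$. *)

theory Defs
  imports "HOL-Analysis.Finite_Cartesian_Product" "HOL-Algebra.Group"
begin

(* The index type 'd is nonempty and finite, so nat ^ 'd ranges over N^d with d = CARD('d) >= 1.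
   The order on vectors is the componentwise one. *)

definition nat_vec_monoid :: "(nat ^ 'd) monoid" where
  "nat_vec_monoid = \<lparr>carrier = UNIV, mult = (+), one = 0\<rparr>"

definition lower_box :: "nat ^ 'd \<Rightarrow> (nat ^ 'd) set" where
  "lower_box x = {n. n \<le> x}"

end

theory Submission
  imports Defs
begin

text \<open>For \<open>x \<le> h\<close>, the vector \<open>h - x\<close> is the unique
  \<open>y\<close> with \<open>x + y = h\<close>. Hence the box condition says that whenever a sum
  \<open>x + y\<close> lies in \<open>H\<close>, so does \<open>x\<close> or \<open>y\<close>. This
  is the contrapositive of closure of the complement under addition; the identity is in the
  complement because \<open>H\<close> avoids \<open>0\<close>.\<close>

text \<open>Subtraction on \<open>nat\<close> truncates at \<open>0\<close> in each coordinate;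
  \<open>x \<le> h\<close> rules truncation out.\<close>

lemma nat_vec_add_diff_inverse:
  fixes x h :: "nat ^ 'd"
  assumes "x \<le> h"
  shows "x + (h - x) = h"
  using assms by (simp add: vec_eq_iff less_eq_vec_def)

lemma nat_vec_le_add:
  fixes x y :: "nat ^ 'd"
  shows "x \<le> x + y"
  by (simp add: less_eq_vec_def)

lemma submonoid_nat_vec_monoid_iff:
  "submonoid M nat_vec_monoid \<longleftrightarrow> 0 \<in> M \<and> (\<forall>x\<in>M. \<forall>y\<in>M. x + y \<in> M)"
  by (auto simp: submonoid_def nat_vec_monoid_def)

theorem proposition16:
  fixes H :: "(nat ^ 'd) set"
  assumes "H \<subseteq> UNIV - {0}"
  shows "submonoid (UNIV - H) nat_vec_monoid \<longleftrightarrow>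
    (\<forall>h\<in>H. \<forall>x\<in>lower_box h - H. h - x \<in> H)"
proof
  assume M: "submonoid (UNIV - H) nat_vec_monoid"
  show "\<forall>h\<in>H. \<forall>x\<in>lower_box h - H. h - x \<in> H"
  proof (intro ballI)
    fix h x
    assume "h \<in> H" and x: "x \<in> lower_box h - H"
    from x have "x + (h - x) = h"
      by (simp add: lower_box_def nat_vec_add_diff_inverse)
    \<comment> \<open>Were \<open>h - x\<close> outside \<open>H\<close>, closure would put the sum
      \<open>h\<close> outside \<open>H\<close> as well.\<close>
    with M x \<open>h \<in> H\<close> show "h - x \<in> H"
      unfolding submonoid_nat_vec_monoid_iff by (metis DiffD2 DiffI UNIV_I)
  qed
next
  assume box: "\<forall>h\<in>H. \<forall>x\<in>lower_box h - H. h - x \<in> H"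
  have "x + y \<notin> H" if "x \<notin> H" "y \<notin> H" for x y
  proof
    assume "x + y \<in> H"
    moreover have "x \<in> lower_box (x + y) - H"
      using that by (simp add: lower_box_def nat_vec_le_add)
    ultimately have "(x + y) - x \<in> H"
      using box by blast
    \<comment> \<open>The difference is exactly \<open>y\<close>, which was taken outside
      \<open>H\<close>.\<close>
    with that show False by simp
  qed
  with assms show "submonoid (UNIV - H) nat_vec_monoid"
    unfolding submonoid_nat_vec_monoid_iff by auto
qed

end
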